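(* Let $M,C,N,O$ be nonnegative integers with $C$, $O$ and $M$ of the same parity, $C\le M$, $O\ge C$, and $C\ge 1$. Let $k$ be a positive integer such that $$k(O+C)+1-\binom{O+C+1}{2}>\frac{M-C}{2}+N+O.$$ Then $k\in\mathcal{A}_{M+1,C-1,N+1,O-1}$ implies $k\in\mathcal{A}_{M,C,N,O}$.
   Context: $\mathcal{Q}_n$ is the $n$-dimensional binary hypercube: its vertices are all binary sequences of length $n$, adjacent iff they differ in exactly one position. A vertex is even or odd according to the parity of its number of 1's; vertices of one parity are called red and those of the other parity green. A path covering of a graph is a set of vertex-disjoint paths that cover all vertices of the graph. A fault $\mathcal{F}$ in $\mathcal{Q}_n$ is a set of deleted vertices; its mass is $|\mathcal{F}|$ and its charge is $|r(\mathcal{F})-g(\mathcal{F})|$, where $r(\mathcal{F})$, $g(\mathcal{F})$ are the numbers of red and green vertices in $\mathcal{F}$. $\mathcal{Q}_n-\mathcal{F}$ is the subgraph induced by the non-deleted vertices. A pair of vertices (or a path, via its two endpoints) is neutral if the two vertices have opposite parity and charged if they have the same parity; a charged pair is red (green) if its elements are red (green). A set $\mathcal{E}$ of disjoint pairs of vertices is in balance with $\mathcal{F}$ if all vertices in the pairs lie in $\mathcal{Q}_n-\mathcal{F}$ and $r(\mathcal{F})-g(\mathcal{F})=g(\mathcal{E})-r(\mathcal{E})$, where $r(\mathcal{E})$, $g(\mathcal{E})$ are the numbers of red and green pairs in $\mathcal{E}$. For a fault $\mathcal{F}$ of mass $M$ and charge $C$ in $\mathcal{Q}_n$, one can freely prescribe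 ends for a path covering of $\mathcal{Q}_n-\mathcal{F}$ with $N$ neutral paths and $O$ charged paths if (i) there is at least one set $\mathcal{E}$ of disjoint pairs of vertices in balance with $\mathcal{F}$ containing exactly $N$ neutral and $O$ charged pairs, and (ii) for every such $\mathcal{E}$ there is a path covering of $\mathcal{Q}_n-\mathcal{F}$ whose set of pairs of end vertices is $\mathcal{E}$. For nonnegative integers $M,C,N,O$, $\mathcal{A}_{M,C,N,O}$ is the set of nonnegative integers $m$ such that $m\ge\log_2[M+C+2N+2O]$ and for every $n\ge m$ and every fault $\mathcal{F}$ of mass $M$ and charge $C$ in $\mathcal{Q}_n$ one can freely prescribe ends for a path covering of $\mathcal{Q}_n-\mathcal{F}$ with $N$ neutral and $O$ charged paths. *)

theory Defs
  imports Complex_Main "Graph_Theory.Digraph_Component" "Graph_Theory.Vertex_Walk"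
begin

text \<open>
  Undirected graphs are symmetric digraphs, as usual in Graph_Theory: each edge of the
  hypercube is represented by its two orientations.
\<close>

definition hypercube :: "nat \<Rightarrow> (bool list, bool list \<times> bool list) pre_digraph" where
  "hypercube n =
     \<lparr> verts = {v. length v = n},
       arcs = {(u, v). length u = n \<and> length v = n \<and> card {i. i < n \<and> u ! i \<noteq> v ! i} = 1},
       tail = fst, head = snd \<rparr>"

text \<open>
  Red is fixed to mean even. All notions below are invariant under exchanging
  the two colours, so the choice is immaterial.
\<close>

definition red :: "bool list \<Rightarrow> bool" where
  "red v \<longleftrightarrow> even (count_list v True)"

abbreviation green :: "bool list \<Rightarrow> bool" where
  "green v \<equiv> \<not> red v"

definition fault :: "nat \<Rightarrow> bool list set \<Rightarrow> bool" where
  "fault n F \<longleftrightarrow> F \<subseteq> verts (hypercube n)"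

definition mass :: "bool list set \<Rightarrow> nat" where
  "mass F = card F"

definition charge_diff :: "bool list set \<Rightarrow> int" where
  "charge_diff F = int (card {v \<in> F. red v}) - int (card {v \<in> F. green v})"

definition charge :: "bool list set \<Rightarrow> nat" where
  "charge F = nat \<bar>charge_diff F\<bar>"

definition faulty_hypercube ::
    "nat \<Rightarrow> bool list set \<Rightarrow> (bool list, bool list \<times> bool list) pre_digraph" where
  "faulty_hypercube n F = hypercube n \<restriction> (verts (hypercube n) - F)"

text \<open>A pair of vertices is an unordered pair of two distinct vertices, i.e. a set of
  cardinality 2.\<close>

definition neutral_pair :: "bool list set \<Rightarrow> bool" where
  "neutral_pair e \<longleftrightarrow> (\<exists>u v. e = {u, v} \<and> red u \<and> green v)"

definition red_pair :: "bool list set \<Rightarrow> bool" where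
  "red_pair e \<longleftrightarrow> (\<exists>u v. e = {u, v} \<and> u \<noteq> v \<and> red u \<and> red v)"

definition green_pair :: "bool list set \<Rightarrow> bool" where
  "green_pair e \<longleftrightarrow> (\<exists>u v. e = {u, v} \<and> u \<noteq> v \<and> green u \<and> green v)"

definition charged_pair :: "bool list set \<Rightarrow> bool" where
  "charged_pair e \<longleftrightarrow> red_pair e \<or> green_pair e"

definition disjoint_pairs :: "'a set set \<Rightarrow> bool" where
  "disjoint_pairs E \<longleftrightarrow> (\<forall>e\<in>E. card e = 2) \<and> pairwise disjnt E"

definition in_balance :: "nat \<Rightarrow> bool list set \<Rightarrow> bool list set set \<Rightarrow> bool" where
  "in_balance n F E \<longleftrightarrow>
     \<Union>E \<subseteq> verts (faulty_hypercube n F) \<and>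
     charge_diff F = int (card {e \<in> E. green_pair e}) - int (card {e \<in> E. red_pair e})"

text \<open>A path is given by the list of its vertices; no two different lists in a covering are
  reversals of each other, since their vertex sets are disjoint.\<close>

definition path_covering :: "('a, 'b) pre_digraph \<Rightarrow> 'a list set \<Rightarrow> bool" where
  "path_covering G P \<longleftrightarrow>
     (\<forall>p\<in>P. vpath p G) \<and> pairwise (\<lambda>p q. disjnt (set p) (set q)) P \<and>
     (\<Union>p\<in>P. set p) = verts G"

definition path_ends :: "'a list \<Rightarrow> 'a set" where
  "path_ends p = {hd p, last p}"

definition admissible_ends ::
    "nat \<Rightarrow> bool list set \<Rightarrow> nat \<Rightarrow> nat \<Rightarrow> bool list set set \<Rightarrow> bool" where
  "admissible_ends n F nn nc E \<longleftrightarrow>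
     disjoint_pairs E \<and> in_balance n F E \<and>
     card {e \<in> E. neutral_pair e} = nn \<and> card {e \<in> E. charged_pair e} = nc"

definition freely_prescribe_ends :: "nat \<Rightarrow> bool list set \<Rightarrow> nat \<Rightarrow> nat \<Rightarrow> bool" where
  "freely_prescribe_ends n F nn nc \<longleftrightarrow>
     (\<exists>E. admissible_ends n F nn nc E) \<and>
     (\<forall>E. admissible_ends n F nn nc E \<longrightarrow>
        (\<exists>P. path_covering (faulty_hypercube n F) P \<and> path_ends ` P = E))"

text \<open>For \<open>M = C = nn = nc = 0\<close> the logarithmic bound is vacuous, both with the convention
  \<open>log 2 0 = 0\<close> and with \<open>log 2 0 = - \<infinity>\<close>.\<close>

definition A_set :: "nat \<Rightarrow> nat \<Rightarrow> nat \<Rightarrow> nat \<Rightarrow> nat set" where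
  "A_set M C nn nc =
     {m. real m \<ge> log 2 (real (M + C + 2 * nn + 2 * nc)) \<and>
         (\<forall>n\<ge>m. \<forall>F. fault n F \<and> mass F = M \<and> charge F = C \<longrightarrow>
            freely_prescribe_ends n F nn nc)}"

end

theory Submission
  imports Defs
begin

text \<open>
  Let \<open>F\<close> be a fault with \<open>C \<ge> 1\<close> more deleted vertices of colour \<open>b\<close> than of the other
  colour, and let \<open>E\<close> be a prescribed set of ends.  Balance forces \<open>(nc + C) / 2\<close> of the
  charged pairs to have the colour opposite to \<open>b\<close>.  Suppose some vertex \<open>u\<close> of such a pair
  \<open>{u, v}\<close> has a neighbour \<open>w\<close> that is neither deleted nor an end.  Then \<open>u\<close> can be deleted and
  \<open>{u, v}\<close> replaced by the neutral pair \<open>{w, v}\<close>: the mass grows by one, the charge drops by one,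
  and a charged pair has become a neutral one.  In a covering for the new data, the path between \<open>w\<close>
  and \<open>v\<close> is prolonged by the edge from \<open>w\<close> to \<open>u\<close>, which gives a covering for \<open>F\<close> and \<open>E\<close>.

  The numerical hypothesis is exactly what makes \<open>w\<close> exist.  The set \<open>D\<close> of ends lying in
  charged pairs of the colour opposite to \<open>b\<close> has \<open>nc + C\<close> elements, and all its neighbours have
  colour \<open>b\<close>.  The forbidden vertices of colour \<open>b\<close> are the \<open>(M + C) / 2\<close> deleted ones and the
  \<open>nn + (nc - C)\<close> ends, so \<open>(M - C) / 2 + nn + nc\<close> altogether.  On the other hand, \<open>j \<ge> 1\<close> vertices
  of the \<open>n\<close>-cube always have at least \<open>n * j + 1 - ((j + 1) choose 2)\<close> neighbours
  (\<open>card_nbhd_lower_bound\<close>), and the hypothesis says that this exceeds the number of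
  forbidden vertices (\<open>free_neighbour_exists\<close>).

  That some admissible set of ends exists at all follows from the reverse exchange: delete one more
  vertex \<open>u\<close> of the minority colour, take ends admissible for the larger fault, and replace the end of
  colour \<open>b\<close> in a neutral pair by \<open>u\<close>.
\<close>

section \<open>Neighbourhoods in the hypercube\<close>

abbreviation flip :: "bool list \<Rightarrow> nat \<Rightarrow> bool list" where
  "flip v i \<equiv> v[i := \<not> v ! i]"

definition nbhd :: "bool list set \<Rightarrow> bool list set" where
  "nbhd S = {flip v i |v i. v \<in> S \<and> i < length v}"

lemma red_Cons: "red (x # v) \<longleftrightarrow> red v = (\<not> x)"
  by (auto simp: red_def)

lemma red_flip: "i < length v \<Longrightarrow> red (flip v i) = (\<not> red v)"
proof (induction v arbitrary: i)
  case (Cons a v)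
  then show ?case by (cases i) (auto simp: red_Cons)
qed simp

lemma finite_cube: "finite {v :: bool list. length v = n}"
  using finite_lists_length_eq[of "UNIV :: bool set" n] by simp

lemma card_cube: "card {v :: bool list. length v = n} = 2 ^ n"
  using card_lists_length_eq[of "UNIV :: bool set" n] by simp

lemma nbhd_length: "S \<subseteq> {v. length v = n} \<Longrightarrow> nbhd S \<subseteq> {v. length v = n}"
  by (auto simp: nbhd_def)

lemma card_slices:
  assumes "finite S" "[] \<notin> S"
  shows "card S = card {v. True # v \<in> S} + card {v. False # v \<in> S}"
proof -
  let ?S = "\<lambda>a. {v. a # v \<in> S}"
  have "S = (#) True ` ?S True \<union> (#) False ` ?S False"
  proof (intro set_eqI iffI)
    fix v assume "v \<in> S"
    then show "v \<in> (#) True ` ?S True \<union> (#) False ` ?S False"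
      using assms(2) by (cases v; cases "hd v") auto
  qed auto
  then have "card S = card ((#) True ` ?S True \<union> (#) False ` ?S False)" by simp
  also have "\<dots> = card ((#) True ` ?S True) + card ((#) False ` ?S False)"
  proof (rule card_Un_disjoint)
    have "\<And>a. (#) a ` ?S a \<subseteq> S" by auto
    then show "finite ((#) True ` ?S True)" "finite ((#) False ` ?S False)"
      using assms(1) finite_subset by blast+
  qed auto
  finally show ?thesis by (simp add: card_image)
qed

text \<open>The neighbours in one facet of the cube include those along edges inside the facet and, for each
  element of \<open>S\<close> in the opposite facet, the vertex straight across.\<close>

lemma nbhd_slice:
  "nbhd {v. a # v \<in> S} \<union> {v. (\<not> a) # v \<in> S} \<subseteq> {v. a # v \<in> nbhd S}"
proof
  fix w assume "w \<in> nbhd {v. a # v \<in> S} \<union> {v. (\<not> a) # v \<in> S}"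
  then show "w \<in> {v. a # v \<in> nbhd S}"
  proof
    assume "w \<in> nbhd {v. a # v \<in> S}"
    then obtain v i where "a # v \<in> S" "i < length v" "w = flip v i"
      by (auto simp: nbhd_def)
    then have "a # v \<in> S \<and> Suc i < length (a # v) \<and> a # w = flip (a # v) (Suc i)" by simp
    then show ?thesis unfolding nbhd_def by blast
  next
    assume "w \<in> {v. (\<not> a) # v \<in> S}"
    then have "(\<not> a) # w \<in> S \<and> 0 < length ((\<not> a) # w) \<and> a # w = flip ((\<not> a) # w) 0" by simp
    then show ?thesis unfolding nbhd_def by blast
  qed
qed

lemma double_choose_two: "2 * (Suc m choose 2) = m * m + m"
  by (induction m) (auto simp: numeral_2_eq_2)

text \<open>Induction on the dimension, cutting \<open>S\<close> along the first coordinate.  If \<open>S\<close> lies in one facet,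
  the opposite facet contributes \<open>card S\<close> further neighbours, which is what the bound gains when
  \<open>n\<close> grows by one.  If both parts are nonempty, of sizes \<open>p\<close> and \<open>q\<close>, the bounds for
  the two parts already add up to enough, the surplus being
  \<open>p * q + 1 - (p + q) = (p - 1) * (q - 1) \<ge> 0\<close>.\<close>

lemma card_nbhd_lower_bound:
  assumes "S \<subseteq> {v. length v = n}" "S \<noteq> {}"
  shows "n * card S + 1 \<le> card (nbhd S) + (Suc (card S) choose 2)"
  using assms
proof (induction n arbitrary: S)
  case 0
  then have "S = {[]}" by auto
  then show ?case by (simp add: numeral_2_eq_2)
next
  case (Suc n)
  define A where "A a = {v. a # v \<in> S}" for a
  define B where "B a = {v. a # v \<in> nbhd S}" for a
  have finS: "finite S" and finN: "finite (nbhd S)"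
    using finite_subset[OF Suc.prems(1) finite_cube]
      finite_subset[OF nbhd_length[OF Suc.prems(1)] finite_cube] .
  have len: "[] \<notin> S" "[] \<notin> nbhd S"
    using Suc.prems(1) nbhd_length[OF Suc.prems(1)] by auto
  have lenA: "A a \<subseteq> {v. length v = n}" and lenB: "B a \<subseteq> {v. length v = n}" for a
    using Suc.prems(1) nbhd_length[OF Suc.prems(1)] by (auto simp: A_def B_def)
  have finA: "finite (A a)" and finB: "finite (B a)" for a
    using finite_subset[OF lenA finite_cube] finite_subset[OF lenB finite_cube] .
  have cS: "card S = card (A a) + card (A (\<not> a))" for a
    using card_slices[OF finS] len(1) by (cases a) (auto simp: A_def)
  have cN: "card (nbhd S) = card (B a) + card (B (\<not> a))" for a
    using card_slices[OF finN] len(2) by (cases a) (auto simp: B_def)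
  have step: "card (nbhd (A a)) \<le> card (B a)" "card (A (\<not> a)) \<le> card (B a)" for a
    using nbhd_slice[of a S] finB[of a] by (auto simp: A_def B_def intro!: card_mono)
  show ?case
  proof (cases "\<exists>a. A (\<not> a) = {}")
    case True
    then obtain a where a: "A (\<not> a) = {}" by blast
    then have j: "card S = card (A a)" using cS[of a] by simp
    then have "A a \<noteq> {}" using Suc.prems(2) finS by auto
    then have "n * card S + 1 \<le> card (B a) + (Suc (card S) choose 2)"
      using Suc.IH[OF lenA[of a]] step(1)[of a] j by simp
    moreover have "card S \<le> card (B (\<not> a))" using step(2)[of "\<not> a"] j by simp
    ultimately show ?thesis using cN[of a] by simp
  next
    case False
    then have ne: "A True \<noteq> {}" "A False \<noteq> {}" by (metis (full_types))+
    define p q where "p = card (A True)" and "q = card (A False)"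
    have "p \<ge> 1" "q \<ge> 1"
      using ne finA by (auto simp: p_def q_def Suc_le_eq card_gt_0_iff)
    then obtain p' q' where pq': "p = Suc p'" "q = Suc q'" by (metis Suc_le_D One_nat_def)
    have "n * p + 1 \<le> card (B True) + (Suc p choose 2)"
      using Suc.IH[OF lenA ne(1)] step(1)[of True] by (simp add: p_def)
    moreover have "n * q + 1 \<le> card (B False) + (Suc q choose 2)"
      using Suc.IH[OF lenA ne(2)] step(1)[of False] by (simp add: q_def)
    \<comment> \<open>Doubled, the difference of the two sides is \<open>2 * (p - 1) * (q - 1)\<close>.\<close>
    moreover have "(Suc p choose 2) + (Suc q choose 2) + p + q \<le> (Suc (p + q) choose 2) + 1"
    proof -
      have "2 * ((Suc p choose 2) + (Suc q choose 2) + p + q) \<le> 2 * ((Suc (p + q) choose 2) + 1)"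
        unfolding distrib_left double_choose_two pq' by (simp add: algebra_simps)
      then show ?thesis by simp
    qed
    ultimately have "Suc n * (p + q) + 1 \<le> card (B True) + card (B False) + (Suc (p + q) choose 2)"
      by (simp add: algebra_simps)
    then show ?thesis using cS[of True] cN[of True] by (simp add: p_def q_def)
  qed
qed

text \<open>The first coordinate is determined by the colour and the remaining coordinates.\<close>

lemma card_colour_class:
  assumes "n > 0"
  shows "card {v. length v = n \<and> red v = b} = 2 ^ (n - 1)"
proof -
  obtain m where m: "n = Suc m" using assms gr0_implies_Suc by blast
  have "bij_betw tl {v. length v = n \<and> red v = b} {v. length v = m}"
  proof (rule bij_betw_byWitness[where f' = "\<lambda>v. (red v \<noteq> b) # v"])
    show "\<forall>v\<in>{v. length v = n \<and> red v = b}. (red (tl v) \<noteq> b) # tl v = v"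
    proof
      fix v assume "v \<in> {v. length v = n \<and> red v = b}"
      then show "(red (tl v) \<noteq> b) # tl v = v"
        using m by (cases v) (auto simp: red_Cons)
    qed
  qed (auto simp: m red_Cons)
  then show ?thesis using card_cube[of m] m by (simp add: bij_betw_same_card)
qed

section \<open>Balance seen from either colour\<close>

text \<open>The colour is a parameter here and below, so that faults with a surplus of red and faults with a
  surplus of green vertices are handled by the same argument.\<close>

definition mono_pair :: "bool \<Rightarrow> bool list set \<Rightarrow> bool" where
  "mono_pair b e \<longleftrightarrow> (\<exists>u v. e = {u, v} \<and> u \<noteq> v \<and> red u = b \<and> red v = b)"

definition excess :: "bool \<Rightarrow> bool list set \<Rightarrow> int" where
  "excess b F = int (card {v \<in> F. red v = b}) - int (card {v \<in> F. red v \<noteq> b})"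

lemma charge_eq_abs_excess: "charge F = nat \<bar>excess b F\<bar>"
  by (cases b) (auto simp: charge_def charge_diff_def excess_def)

lemma excess_insert:
  assumes "finite F" "u \<notin> F" "red u \<noteq> b"
  shows "excess b (insert u F) = excess b F - 1"
proof -
  have "{v \<in> insert u F. red v = b} = {v \<in> F. red v = b}"
    "{v \<in> insert u F. red v \<noteq> b} = insert u {v \<in> F. red v \<noteq> b}"
    using assms by auto
  then show ?thesis using assms by (simp add: excess_def)
qed

lemma mass_excess:
  assumes "finite F"
  shows "2 * int (card {v \<in> F. red v = b}) = int (mass F) + excess b F"
    and "2 * int (card {v \<in> F. red v \<noteq> b}) = int (mass F) - excess b F"
proof -
  have "F = {v \<in> F. red v = b} \<union> {v \<in> F. red v \<noteq> b}" by auto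
  then have "card F = card ({v \<in> F. red v = b} \<union> {v \<in> F. red v \<noteq> b})" by simp
  also have "\<dots> = card {v \<in> F. red v = b} + card {v \<in> F. red v \<noteq> b}"
    using assms by (intro card_Un_disjoint) auto
  finally show "2 * int (card {v \<in> F. red v = b}) = int (mass F) + excess b F"
    "2 * int (card {v \<in> F. red v \<noteq> b}) = int (mass F) - excess b F"
    by (auto simp: mass_def excess_def)
qed

lemma mono_pair_pair: "mono_pair b {u, v} \<longleftrightarrow> u \<noteq> v \<and> red u = b \<and> red v = b"
  by (auto simp: mono_pair_def doubleton_eq_iff)

lemma neutral_pair_pair: "neutral_pair {u, v} \<longleftrightarrow> red u \<noteq> red v"
  by (auto simp: neutral_pair_def doubleton_eq_iff)

lemma verts_faulty: "verts (faulty_hypercube n F) = {v. length v = n} - F"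
  by (simp add: faulty_hypercube_def hypercube_def)

lemma fault_finite: "fault n F \<Longrightarrow> finite F"
  using finite_subset[OF _ finite_cube[of n]] by (simp add: fault_def hypercube_def)

lemma finite_pairs:
  assumes "\<Union>E \<subseteq> {v :: bool list. length v = n} - F"
  shows "finite E"
proof -
  have "finite (\<Union>E)" using assms finite_cube[of n] by (meson finite_Diff finite_subset)
  then show ?thesis by (rule finite_UnionD)
qed

text \<open>Exchanging the two colours negates both sides of the balance equation, so balance may be
  read from the point of view of either colour \<open>b\<close>.\<close>

lemma admissible_ends_iff:
  "admissible_ends n F nn nc E \<longleftrightarrow>
     disjoint_pairs E \<and> \<Union>E \<subseteq> {v. length v = n} - F \<and>
     excess b F = int (card {e \<in> E. mono_pair (\<not> b) e}) - int (card {e \<in> E. mono_pair b e}) \<and>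
     card {e \<in> E. neutral_pair e} = nn \<and>
     card {e \<in> E. mono_pair b e} + card {e \<in> E. mono_pair (\<not> b) e} = nc"
proof (cases "\<Union>E \<subseteq> {v. length v = n} - F")
  case True
  then have fin: "finite E" by (rule finite_pairs)
  have colours: "red_pair = mono_pair True" "green_pair = mono_pair False"
    by (auto simp: red_pair_def green_pair_def mono_pair_def fun_eq_iff)
  have "{e \<in> E. charged_pair e} = {e \<in> E. mono_pair True e} \<union> {e \<in> E. mono_pair False e}"
    by (auto simp: charged_pair_def colours)
  moreover have "card \<dots> = card {e \<in> E. mono_pair True e} + card {e \<in> E. mono_pair False e}"
    using fin by (intro card_Un_disjoint) (auto simp: mono_pair_def doubleton_eq_iff)
  ultimately show ?thesis
    by (cases b)
      (auto simp: admissible_ends_def in_balance_def verts_faulty colours charge_diff_def excess_def)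
qed (auto simp: admissible_ends_def in_balance_def verts_faulty)

lemma admissible_endsD:
  assumes "admissible_ends n F nn nc E"
  shows "disjoint_pairs E" "\<Union>E \<subseteq> {v. length v = n} - F"
  using assms by (auto simp: admissible_ends_def in_balance_def verts_faulty)

section \<open>Exchanging one end\<close>

lemma pair_unique:
  assumes "disjoint_pairs E" "e \<in> E" "e' \<in> E" "x \<in> e" "x \<in> e'"
  shows "e = e'"
  using assms by (auto simp: disjoint_pairs_def pairwise_def disjnt_def)

context
  fixes E :: "'a set set" and x y z
  assumes E: "disjoint_pairs E" and e: "{x, y} \<in> E" and xy: "x \<noteq> y" and z: "z \<notin> \<Union>E"
begin

lemma disjoint_pairs_exchange: "disjoint_pairs (insert {z, y} (E - {{x, y}}))"
proof -
  have "z \<noteq> y" using z e by auto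
  moreover have "disjnt {z, y} f" if "f \<in> E - {{x, y}}" for f
    using that pair_unique[OF E e, of f y] z by (auto simp: disjnt_def)
  moreover have "pairwise disjnt (E - {{x, y}})"
    using E by (auto simp: disjoint_pairs_def intro: pairwise_subset)
  ultimately show ?thesis using E
    by (auto simp: disjoint_pairs_def pairwise_insert disjnt_sym)
qed

lemma Union_exchange: "\<Union>(insert {z, y} (E - {{x, y}})) = insert z (\<Union>E - {x})"
proof -
  have "x \<notin> \<Union>(E - {{x, y}})" using pair_unique[OF E e, of _ x] by blast
  moreover have "\<Union>E = {x, y} \<union> \<Union>(E - {{x, y}})" using e by blast
  ultimately show ?thesis using xy by auto
qed

lemma exchange_back: "insert {x, y} (insert {z, y} (E - {{x, y}}) - {{z, y}}) = E"
proof -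
  have "{z, y} \<notin> E" using z by blast
  then show ?thesis using e by blast
qed

text \<open>Stated additively, because a difference of cardinalities would be truncated.\<close>

lemma card_filter_exchange:
  assumes "finite E"
  shows "card {f \<in> insert {z, y} (E - {{x, y}}). P f} + of_bool (P {x, y})
       = card {f \<in> E. P f} + of_bool (P {z, y})"
proof -
  define R where "R = {f \<in> E - {{x, y}}. P f}"
  have R: "finite R" "{x, y} \<notin> R" "{z, y} \<notin> R" using assms z by (auto simp: R_def)
  have "{f \<in> E. P f} = (if P {x, y} then insert {x, y} R else R)" using e by (auto simp: R_def)
  then have 1: "card {f \<in> E. P f} = card R + of_bool (P {x, y})"
    using R by simp
  have "{f \<in> insert {z, y} (E - {{x, y}}). P f} = (if P {z, y} then insert {z, y} R else R)"
    by (auto simp: R_def)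
  then have "card {f \<in> insert {z, y} (E - {{x, y}}). P f} = card R + of_bool (P {z, y})"
    using R by simp
  then show ?thesis using 1 by simp
qed

end

text \<open>Deleting \<open>u\<close> lowers the surplus of colour \<open>b\<close> by one, and turning a pair of the other colour
  into a neutral one lowers the required surplus by one as well, so balance is kept.\<close>

lemma admissible_ends_neutralize:
  assumes adm: "admissible_ends n F nn nc E" and "finite F"
    and e: "{u, v} \<in> E" "u \<noteq> v" and col: "red u \<noteq> b" "red v \<noteq> b" "red w = b"
    and w: "w \<notin> \<Union>E" "w \<notin> F" "length w = n"
  shows "admissible_ends n (insert u F) (nn + 1) (nc - 1) (insert {w, v} (E - {{u, v}}))"
proof -
  note adm' = adm[unfolded admissible_ends_iff[of _ _ _ _ _ b]]
  have E: "disjoint_pairs E" and sub: "\<Union>E \<subseteq> {v. length v = n} - F"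
    using admissible_endsD[OF adm] .
  have fin: "finite E" using sub by (rule finite_pairs)
  have u: "u \<notin> F" using e sub by auto
  let ?E = "insert {w, v} (E - {{u, v}})"
  note count = card_filter_exchange[OF E e w(1) fin]
  have "card {f \<in> ?E. neutral_pair f} = card {f \<in> E. neutral_pair f} + 1"
    using count[of neutral_pair] col by (simp add: neutral_pair_pair)
  moreover have "card {f \<in> ?E. mono_pair b f} = card {f \<in> E. mono_pair b f}"
    using count[of "mono_pair b"] col by (simp add: mono_pair_pair)
  moreover have "card {f \<in> ?E. mono_pair (\<not> b) f} + 1 = card {f \<in> E. mono_pair (\<not> b) f}"
    using count[of "mono_pair (\<not> b)"] col e by (simp add: mono_pair_pair)
  moreover have "excess b (insert u F) = excess b F - 1"
    using \<open>finite F\<close> u col by (intro excess_insert) auto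
  moreover have "\<Union>?E \<subseteq> {v. length v = n} - insert u F"
    unfolding Union_exchange[OF E e w(1)] using sub w e by auto
  ultimately show ?thesis
    using disjoint_pairs_exchange[OF E e w(1)] adm'
    unfolding admissible_ends_iff[of _ _ _ _ _ b] by auto
qed

text \<open>The inverse exchange: \<open>u\<close> is restored to the graph and takes over as an end from the
  colour-\<open>b\<close> vertex \<open>w\<close>.\<close>

lemma admissible_ends_charge:
  assumes adm: "admissible_ends n (insert u F) (nn + 1) nc E" and "finite F"
    and e: "{w, v} \<in> E" and col: "red u \<noteq> b" "red v \<noteq> b" "red w = b"
    and u: "u \<notin> F" "length u = n"
  shows "admissible_ends n F nn (nc + 1) (insert {u, v} (E - {{w, v}}))"
proof -
  note adm' = adm[unfolded admissible_ends_iff[of _ _ _ _ _ b]]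
  have E: "disjoint_pairs E" and sub: "\<Union>E \<subseteq> {v. length v = n} - insert u F"
    using admissible_endsD[OF adm] .
  have fin: "finite E" using sub by (rule finite_pairs)
  have u': "u \<notin> \<Union>E" using sub by auto
  then have uv: "u \<noteq> v" using e by auto
  have wv: "w \<noteq> v" using col by auto
  let ?E = "insert {u, v} (E - {{w, v}})"
  note count = card_filter_exchange[OF E e wv u' fin]
  have "card {f \<in> ?E. neutral_pair f} + 1 = card {f \<in> E. neutral_pair f}"
    using count[of neutral_pair] col by (simp add: neutral_pair_pair)
  moreover have "card {f \<in> ?E. mono_pair b f} = card {f \<in> E. mono_pair b f}"
    using count[of "mono_pair b"] col by (simp add: mono_pair_pair)
  moreover have "card {f \<in> ?E. mono_pair (\<not> b) f} = card {f \<in> E. mono_pair (\<not> b) f} + 1"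
    using count[of "mono_pair (\<not> b)"] col uv by (simp add: mono_pair_pair)
  moreover have "excess b (insert u F) = excess b F - 1"
    using \<open>finite F\<close> u col by (intro excess_insert) auto
  moreover have "\<Union>?E \<subseteq> {v. length v = n} - F"
    unfolding Union_exchange[OF E e wv u'] using sub u by auto
  ultimately show ?thesis
    using disjoint_pairs_exchange[OF E e wv u'] adm'
    unfolding admissible_ends_iff[of _ _ _ _ _ b] by auto
qed

section \<open>Finding a free neighbour\<close>

text \<open>Disjointness of the pairs makes this an equality, so the set of ends whose neighbourhood
  is estimated has its full size.\<close>

lemma card_mono_ends:
  assumes "disjoint_pairs E" "finite E"
  shows "card (\<Union>{e \<in> E. mono_pair b e}) = 2 * card {e \<in> E. mono_pair b e}"
proof -
  have "card (\<Union>{e \<in> E. mono_pair b e}) = (\<Sum>e\<in>{e \<in> E. mono_pair b e}. card e)"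
    using assms by (intro card_Union_disjoint)
      (auto simp: disjoint_pairs_def mono_pair_def intro: pairwise_subset)
  also have "\<dots> = (\<Sum>e\<in>{e \<in> E. mono_pair b e}. 2)"
    using assms by (intro sum.cong) (auto simp: disjoint_pairs_def)
  finally show ?thesis by simp
qed

lemma card_coloured_ends_le:
  assumes "disjoint_pairs E" "finite E"
  shows "card {v \<in> \<Union>E. red v = b}
       \<le> card {e \<in> E. neutral_pair e} + 2 * card {e \<in> E. mono_pair b e}"
proof -
  let ?c = "\<lambda>e. {v \<in> e. red v = b}"
  have "{v \<in> \<Union>E. red v = b} = (\<Union>e\<in>E. ?c e)" by auto
  then have "card {v \<in> \<Union>E. red v = b} \<le> (\<Sum>e\<in>E. card (?c e))"
    using card_UN_le[OF assms(2), of ?c] by simp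
  also have "\<dots> \<le> (\<Sum>e\<in>E. of_bool (neutral_pair e) + 2 * of_bool (mono_pair b e))"
  proof (rule sum_mono)
    fix e assume "e \<in> E"
    then have "card e = 2" using assms by (auto simp: disjoint_pairs_def)
    then obtain u v where e: "e = {u, v}" "u \<noteq> v" by (auto simp: card_2_iff)
    have "?c e = (if red u = b then {u} else {}) \<union> (if red v = b then {v} else {})"
      using e by auto
    then have "card (?c e) \<le> of_bool (red u = b) + of_bool (red v = b)"
      using card_Un_le[of "if red u = b then {u} else {}" "if red v = b then {v} else {}"]
      by (auto split: if_splits)
    then show "card (?c e) \<le> of_bool (neutral_pair e) + 2 * of_bool (mono_pair b e)"
      using e by (auto simp: neutral_pair_pair mono_pair_pair split: if_splits)
  qed
  also have "\<dots> = card {e \<in> E. neutral_pair e} + 2 * card {e \<in> E. mono_pair b e}"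
    using assms(2) by (simp add: sum.distrib flip: sum_distrib_left)
      (simp add: of_bool_def sum.If_cases Int_def)
  finally show ?thesis .
qed

text \<open>The forbidden vertices of colour \<open>b\<close> are too few to contain the whole neighbourhood of the
  ends in charged pairs of the other colour; by parity only colour \<open>b\<close> occurs in that neighbourhood.\<close>

lemma free_neighbour_exists:
  assumes adm: "admissible_ends n F nn nc E" and F: "finite F"
    and C: "excess b F = int C" "C \<ge> 1"
    and bound: "real n * (real nc + real C) + 1 - real ((nc + C + 1) choose 2)
           > (real (mass F) - real C) / 2 + real nn + real nc"
  obtains u v i where "{u, v} \<in> E" "u \<noteq> v" "red u \<noteq> b" "red v \<noteq> b" "i < n" "length u = n"
    "flip u i \<notin> \<Union>E" "flip u i \<notin> F"
proof -
  note adm' = adm[unfolded admissible_ends_iff[of _ _ _ _ _ b]]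
  have E: "disjoint_pairs E" and sub: "\<Union>E \<subseteq> {v. length v = n} - F"
    using admissible_endsD[OF adm] .
  have fin: "finite E" using sub by (rule finite_pairs)
  define D where "D = \<Union>{e \<in> E. mono_pair (\<not> b) e}"
  \<comment> \<open>The number of charged pairs is \<open>nc\<close>, and \<open>C\<close> is the difference between the two kinds.\<close>
  have D: "card D = nc + C"
    using card_mono_ends[OF E fin, of "\<not> b"] adm' C by (simp add: D_def)
  have Dsub: "D \<subseteq> {v. length v = n}" using sub by (auto simp: D_def)
  have "D \<noteq> {}" using D C by auto
  from card_nbhd_lower_bound[OF Dsub this]
  have "n * (nc + C) + 1 \<le> card (nbhd D) + (nc + C + 1 choose 2)" by (simp add: D)
  then have "real (n * (nc + C) + 1) \<le> real (card (nbhd D) + (nc + C + 1 choose 2))"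
    by (simp only: of_nat_le_iff)
  then have large: "real n * (real nc + real C) + 1 - real (nc + C + 1 choose 2) \<le> card (nbhd D)"
    by simp
  \<comment> \<open>Forbidden vertices: a neighbour outside \<open>B\<close> has colour \<open>b\<close>, so it is not deleted and not an end.\<close>
  define B where "B = {v \<in> F. red v = b} \<union> {v \<in> \<Union>E. red v = b}"
  have finB: "finite B"
  proof (rule finite_subset)
    show "B \<subseteq> F \<union> \<Union>E" by (auto simp: B_def)
    show "finite (F \<union> \<Union>E)"
      using F finite_subset[OF sub finite_Diff[OF finite_cube]] by blast
  qed
  have "card B \<le> card {v \<in> F. red v = b} + card {v \<in> \<Union>E. red v = b}"
    unfolding B_def by (rule card_Un_le)
  also have "\<dots> \<le> card {v \<in> F. red v = b} + (nn + 2 * card {e \<in> E. mono_pair b e})"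
    using card_coloured_ends_le[OF E fin, of b] adm' by simp
  finally have "2 * int (card B) \<le> int (mass F) - int C + 2 * int nn + 2 * int nc"
    using mass_excess(1)[OF F, of b] adm' C by linarith
  then have "real_of_int (2 * int (card B)) \<le> real_of_int (int (mass F) - int C + 2 * int nn + 2 * int nc)"
    by (simp only: of_int_le_iff)
  then have "real (card B) < card (nbhd D)" using large bound by (simp add: field_simps)
  then have "\<not> nbhd D \<subseteq> B" using card_mono[OF finB, of "nbhd D"] by linarith
  then obtain u i where u: "u \<in> D" "i < length u" "flip u i \<notin> B"
    by (auto simp: nbhd_def)
  then obtain e where "e \<in> E" "mono_pair (\<not> b) e" "u \<in> e" by (auto simp: D_def)
  then obtain v where v: "{u, v} \<in> E" "u \<noteq> v" "red u \<noteq> b" "red v \<noteq> b"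
    by (auto simp: mono_pair_def insert_commute)
  show ?thesis
    using that[OF v, of i] u Dsub red_flip[OF u(2)] v(3) by (auto simp: B_def)
qed

section \<open>Extending a path by one vertex\<close>

lemma arcs_ends_faulty:
  "arcs_ends (faulty_hypercube n F) =
     {(u, v). u \<notin> F \<and> v \<notin> F \<and> length u = n \<and> length v = n \<and> card {i. i < n \<and> u ! i \<noteq> v ! i} = 1}"
  by (auto simp: arcs_ends_conv faulty_hypercube_def hypercube_def)

lemma flip_arcs:
  assumes "length u = n" "i < n" "u \<notin> F" "flip u i \<notin> F"
  shows "(u, flip u i) \<in> arcs_ends (faulty_hypercube n F)"
    and "(flip u i, u) \<in> arcs_ends (faulty_hypercube n F)"
proof -
  have "{j. j < n \<and> u ! j \<noteq> flip u i ! j} = {i}" "{j. j < n \<and> flip u i ! j \<noteq> u ! j} = {i}"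
    using assms by (auto simp: nth_list_update)
  then show "(u, flip u i) \<in> arcs_ends (faulty_hypercube n F)"
    "(flip u i, u) \<in> arcs_ends (faulty_hypercube n F)"
    using assms by (simp_all add: arcs_ends_faulty)
qed

text \<open>A covering may list a path in either direction, so the new vertex has to be attached at the front
  or at the back, whichever holds \<open>w\<close>.\<close>

lemma vpath_extend:
  assumes p: "vpath p G" and ends: "path_ends p = {w, v}" "w \<noteq> v"
    and u: "u \<in> verts G" "u \<notin> set p"
    and arcs: "(u, w) \<in> arcs_ends G" "(w, u) \<in> arcs_ends G"
  obtains q where "vpath q G" "set q = insert u (set p)" "path_ends q = {u, v}"
proof -
  have "p \<noteq> []" using p by (auto simp: vpath_def vwalk_def)
  consider "hd p = w" "last p = v" | "hd p = v" "last p = w"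
    using ends by (auto simp: path_ends_def doubleton_eq_iff)
  then show ?thesis
  proof cases
    case 1
    then have "vpath (u # p) G"
      using p u arcs by (auto simp: vpath_def intro: vwalk_consI)
    then show ?thesis using that[of "u # p"] 1 \<open>p \<noteq> []\<close> by (auto simp: path_ends_def)
  next
    case 2
    then have "vpath (p @ [u]) G"
      using p u arcs \<open>p \<noteq> []\<close> by (auto simp: vpath_def vwalk_def vwalk_arcs_append)
    then show ?thesis using that[of "p @ [u]"] 2 \<open>p \<noteq> []\<close> by (auto simp: path_ends_def)
  qed
qed

lemma path_covering_extend:
  assumes P: "path_covering (faulty_hypercube n (insert u F)) P"
    and e: "{w, v} \<in> path_ends ` P" "w \<noteq> v"
    and u: "length u = n" "u \<notin> F" and i: "i < n" "w = flip u i"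
  obtains P' where "path_covering (faulty_hypercube n F) P'"
    "path_ends ` P' = insert {u, v} (path_ends ` P - {{w, v}})"
proof -
  let ?G = "faulty_hypercube n F" and ?G' = "faulty_hypercube n (insert u F)"
  have paths: "vpath p ?G'" if "p \<in> P" for p using P that by (auto simp: path_covering_def)
  have dis: "p = q" if "p \<in> P" "q \<in> P" "x \<in> set p" "x \<in> set q" for p q x
    using P that by (auto simp: path_covering_def pairwise_def disjnt_def)
  have cover: "(\<Union>p\<in>P. set p) = {v. length v = n} - insert u F"
    using P by (auto simp: path_covering_def verts_faulty)
  have verts: "verts ?G = insert u (\<Union>p\<in>P. set p)"
    using u by (auto simp: cover verts_faulty)
  have up: "u \<notin> set p" if "p \<in> P" for p using cover that by auto
  have mono: "vpath p ?G" if "p \<in> P" for p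
    using paths[OF that] by (auto simp: vpath_def vwalk_def verts_faulty arcs_ends_faulty)
  have ends: "path_ends p \<subseteq> set p" "path_ends p \<noteq> {}" if "p \<in> P" for p
    using paths[OF that] by (auto simp: vpath_def vwalk_def path_ends_def)
  \<comment> \<open>Only one path has the ends \<open>{w, v}\<close>, so this pair disappears when that path is replaced.\<close>
  have inj: "inj_on path_ends P"
  proof (rule inj_onI)
    fix p q assume pq: "p \<in> P" "q \<in> P" "path_ends p = path_ends q"
    then obtain x where "x \<in> path_ends p" using ends by blast
    then show "p = q" using dis[of p q x] pq ends by blast
  qed
  obtain p where p: "p \<in> P" "path_ends p = {w, v}" using e by auto
  have "w \<in> set p" using ends[OF p(1)] p(2) by auto
  then have "w \<notin> F" using cover p(1) by auto
  then obtain q where q: "vpath q ?G" "set q = insert u (set p)" "path_ends q = {u, v}"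
    using vpath_extend[OF mono[OF p(1)] p(2) e(2), of u] verts up[OF p(1)] flip_arcs[of u n i F] u i
    by auto
  define P' where "P' = insert q (P - {p})"
  have "disjnt (set q) (set p')" if "p' \<in> P - {p}" for p'
    using that q(2) up[of p'] dis[OF p(1), of p'] by (auto simp: disjnt_def)
  moreover have "pairwise (\<lambda>p q. disjnt (set p) (set q)) (P - {p})"
    using P by (auto simp: path_covering_def intro: pairwise_subset)
  moreover have "(\<Union>p\<in>P'. set p) = verts ?G" using q(2) p(1) verts by (auto simp: P'_def)
  ultimately have "path_covering ?G P'"
    using q(1) mono by (auto simp: path_covering_def P'_def pairwise_insert disjnt_sym)
  moreover have "path_ends ` P' = insert {u, v} (path_ends ` P - {{w, v}})"
    using inj_on_image_set_diff[OF inj, of P "{p}"] p q(3) by (simp add: P'_def)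
  ultimately show ?thesis by (rule that)
qed

section \<open>Trading a charged path for a neutral one\<close>

text \<open>The exchange for a single fault.  The assumption \<open>mass F - C < 2 ^ n\<close> says that
  the minority colour is not deleted entirely, since twice its number of deleted vertices is
  \<open>mass F - C\<close>, while each colour class has \<open>2 ^ (n - 1)\<close> vertices.\<close>

lemma freely_prescribe_ends_step:
  assumes F: "fault n F" and b: "excess b F = int C" "C \<ge> 1" and nc: "nc \<ge> 1"
    and room: "mass F - C < 2 ^ n" and "n > 0"
    and bound: "real n * (real nc + real C) + 1 - real ((nc + C + 1) choose 2)
           > (real (mass F) - real C) / 2 + real nn + real nc"
    and hyp: "\<And>u. \<lbrakk>length u = n; u \<notin> F; red u \<noteq> b\<rbrakk> \<Longrightarrow>
       freely_prescribe_ends n (insert u F) (nn + 1) (nc - 1)"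
  shows "freely_prescribe_ends n F nn nc"
  unfolding freely_prescribe_ends_def
proof (intro conjI allI impI)
  have fin: "finite F" using F by (rule fault_finite)
  show "\<exists>E. admissible_ends n F nn nc E"
  proof -
    have "2 * card {v \<in> F. red v \<noteq> b} < 2 ^ n"
      using mass_excess(2)[OF fin, of b] b room by linarith
    moreover have "(2 :: nat) ^ n = 2 * 2 ^ (n - 1)" using \<open>n > 0\<close> by (cases n) auto
    ultimately have "card {v \<in> F. red v \<noteq> b} < card {v. length v = n \<and> red v = (\<not> b)}"
      using card_colour_class[OF \<open>n > 0\<close>, of "\<not> b"] by simp
    then have "\<not> {v. length v = n \<and> red v = (\<not> b)} \<subseteq> {v \<in> F. red v \<noteq> b}"
      using card_mono[of "{v \<in> F. red v \<noteq> b}"] fin by (auto simp: not_le[symmetric])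
    then obtain u where u: "length u = n" "u \<notin> F" "red u \<noteq> b" by auto
    obtain E where E: "admissible_ends n (insert u F) (nn + 1) (nc - 1) E"
      using hyp[OF u] by (auto simp: freely_prescribe_ends_def)
    then have "{e \<in> E. neutral_pair e} \<noteq> {}"
      by (intro notI) (simp add: admissible_ends_def)
    then obtain w v where "{w, v} \<in> E" "red w = b" "red v \<noteq> b"
      unfolding neutral_pair_def by (cases b) (auto simp: insert_commute)
    from admissible_ends_charge[OF E fin this(1) u(3) this(3,2) u(2,1)]
    show ?thesis using nc by auto
  qed
next
  fix E assume E: "admissible_ends n F nn nc E"
  have fin: "finite F" using F by (rule fault_finite)
  obtain u v i where uv: "{u, v} \<in> E" "u \<noteq> v" "red u \<noteq> b" "red v \<noteq> b"
    and i: "i < n" "length u = n" "flip u i \<notin> \<Union>E" "flip u i \<notin> F"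
    using free_neighbour_exists[OF E fin b bound] .
  define w where "w = flip u i"
  have w: "red w = b" "length w = n" "w \<notin> \<Union>E" "w \<notin> F"
    using red_flip[of i u] i uv by (auto simp: w_def)
  have u: "u \<notin> F" using E uv(1) by (auto simp: admissible_ends_def in_balance_def verts_faulty)
  have "admissible_ends n (insert u F) (nn + 1) (nc - 1) (insert {w, v} (E - {{u, v}}))"
    using admissible_ends_neutralize[OF E fin uv w(1,3,4,2)] .
  then obtain P where P: "path_covering (faulty_hypercube n (insert u F)) P"
    "path_ends ` P = insert {w, v} (E - {{u, v}})"
    using hyp[OF i(2) u uv(3)] by (auto simp: freely_prescribe_ends_def)
  have wv: "w \<noteq> v" "{w, v} \<in> path_ends ` P" using w(1) uv(4) P(2) by auto
  obtain P' where "path_covering (faulty_hypercube n F) P'"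
    "path_ends ` P' = insert {u, v} (path_ends ` P - {{w, v}})"
    using path_covering_extend[OF P(1) wv(2,1) i(2) u i(1) w_def] .
  moreover have "insert {u, v} (path_ends ` P - {{w, v}}) = E"
    unfolding P(2) using exchange_back[OF _ uv(1,2) w(3)] E by (simp add: admissible_ends_def)
  ultimately show "\<exists>P. path_covering (faulty_hypercube n F) P \<and> path_ends ` P = E" by auto
qed

text \<open>The sum \<open>M + C + 2 * nn + 2 * nc\<close> is the same for both parameter tuples, so the logarithmic condition
  carries over; it also bounds the mass from above.  Passing from \<open>k\<close> to a larger dimension
  only strengthens the numerical inequality.\<close>

theorem lemma5p5:
  fixes M C nn nc k :: nat
  assumes "even C \<longleftrightarrow> even M" and "even nc \<longleftrightarrow> even M"
    and "C \<le> M" and "nc \<ge> C" and "C \<ge> 1"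
    and "k > 0"
    and "real k * (real nc + real C) + 1 - real ((nc + C + 1) choose 2)
           > (real M - real C) / 2 + real nn + real nc"
    and "k \<in> A_set (M + 1) (C - 1) (nn + 1) (nc - 1)"
  shows "k \<in> A_set M C nn nc"
proof -
  have "M + 1 + (C - 1) + 2 * (nn + 1) + 2 * (nc - 1) = M + C + 2 * nn + 2 * nc"
    using assms(4,5) by simp
  then have log: "log 2 (real (M + C + 2 * nn + 2 * nc)) \<le> real k"
    and hyp: "\<And>n F. \<lbrakk>n \<ge> k; fault n F; mass F = M + 1; charge F = C - 1\<rbrakk> \<Longrightarrow>
      freely_prescribe_ends n F (nn + 1) (nc - 1)"
    using assms(8) unfolding A_set_def mem_Collect_eq by metis+
  have "real (M + C + 2 * nn + 2 * nc) \<le> 2 powr real k"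
    using log assms(5) by (subst (asm) log_le_iff) auto
  then have "real (M + C + 2 * nn + 2 * nc) \<le> real (2 ^ k)" by (simp add: powr_realpow)
  then have size: "M + C + 2 * nn + 2 * nc \<le> 2 ^ k" by (simp only: of_nat_le_iff)
  have "freely_prescribe_ends n F nn nc"
    if n: "n \<ge> k" and F: "fault n F" and M: "mass F = M" and C: "charge F = C" for n F
  proof -
    have "excess False F = - excess True F" by (simp add: excess_def)
    then obtain b where b: "excess b F = int C"
      using charge_eq_abs_excess[of F True] C by (cases "excess True F \<ge> 0") auto
    have fin: "finite F" using F by (rule fault_finite)
    show ?thesis
    proof (rule freely_prescribe_ends_step[OF F b assms(5)])
      show "nc \<ge> 1" "n > 0" using assms n by auto
      have "(2 :: nat) ^ k \<le> 2 ^ n" using n by (rule power_increasing) simp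
      then show "mass F - C < 2 ^ n" using size assms(5) M by linarith
      have "real k * (real nc + real C) \<le> real n * (real nc + real C)"
        using n by (intro mult_right_mono) auto
      then show "real n * (real nc + real C) + 1 - real ((nc + C + 1) choose 2)
           > (real (mass F) - real C) / 2 + real nn + real nc"
        using assms(7) unfolding M by linarith
      fix u assume u: "length u = n" "u \<notin> F" "red u \<noteq> b"
      show "freely_prescribe_ends n (insert u F) (nn + 1) (nc - 1)"
      proof (rule hyp[OF n])
        show "fault n (insert u F)" using F u by (simp add: fault_def hypercube_def)
        show "mass (insert u F) = M + 1" using M fin u by (simp add: mass_def)
        show "charge (insert u F) = C - 1"
          using excess_insert[OF fin u(2,3)] b assms(5)
          by (simp add: charge_eq_abs_excess[of _ b])
      qed
    qed
  qed
  then show ?thesis using log by (auto simp: A_set_def)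
qed

end
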